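(* If $V\in\{0,1\}^{\mathbb{N}}$ is a recurrent, balanced, non-eventually periodic word beginning with $0$, then $V$ has a proper spacer rank-two construction.
   Context: An infinite word $V$ is recurrent if every finite subword of $V$ appears in $V$ infinitely often. It is balanced if for all $n$ and any two subwords of $V$ of length $n$, the numbers of $1$s in these two subwords differ by at most $1$. It is eventually periodic if $V=uvvv\cdots$ for some finite words $u$ (possibly empty) and $v$ (nonempty). Building: $\mathbb{N}$ is the set of nonnegative integers; $\mathcal{F}$ is the set of all finite binary words that start and end with $0$; $1^a$ is $a$ consecutive $1$s. For finite $S\subset\mathcal{F}$, a building of a finite word $w$ from $S$ is an expression $w=v_11^{a_1}v_21^{a_2}\cdots v_k1^{a_k}v_{k+1}$ with $k\ge 1$, $v_i\in S$, $a_i\in\mathbb{N}$; every word of $S$ is used in it if $\{v_1,\dots,v_{k+1}\}=S$. The word $w$ is built from $S$ if such a building exists, and built from $S$ starting with $u$ if there is one with $v_1=u$. Rank one: $V$ has a rank-one construction (equivalently, an at most spacer rank-one construction) if there is a sequence $(v_i)_{i\in\mathbb{N}}$ in $\mathcal{F}$ with $v_0=0$, $v_{i+1}$ built from $\{v_i\}$ and $v_i$ an initial segment of $V$ for all $i$. Proper spacer rank-two: $V$ has a proper spacer rank-two construction if it does not have an at most spacer rank-one construction and there are sets $S_i$ with $S_0=\{0\}$ and, for $i\ge 1$, $S_i=\{v_{i,1},v_{i,2}\}\subset\mathcal{F}$ a set of two words, such that (with $v_{0,1}=v_{0,2}=0$): for every $i\ge0$, $v_{i+1,1}$ is built from $S_i$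 starting with $v_{i,1}$ and $v_{i+1,2}$ is built from $S_i$; every word of $S_i$ is used in the building of $v_{i+1,1}$ and in the building of $v_{i+1,2}$; and $v_{i,1}$ is an initial segment of $V$ for all $i\in\mathbb{N}$. *)

theory Defs
  imports "HOL-Library.Omega_Words_Fun" "HOL-Library.Z2"
begin

text \<open>
  Finite binary words are of type \<^typ>\<open>bit list\<close>, infinite ones of type \<^typ>\<open>bit word\<close>, i.e.
  \<^typ>\<open>nat \<Rightarrow> bit\<close>. The type \<^typ>\<open>bit\<close> only serves as the alphabet with the letters 0 and 1.
\<close>

definition occurs_at :: "bit list \<Rightarrow> bit word \<Rightarrow> nat \<Rightarrow> bool" where
  "occurs_at w V n \<longleftrightarrow> V [n \<rightarrow> n + length w] = w"

definition subword :: "bit list \<Rightarrow> bit word \<Rightarrow> bool" where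
  "subword w V \<longleftrightarrow> (\<exists>n. occurs_at w V n)"

definition initial_segment :: "bit list \<Rightarrow> bit word \<Rightarrow> bool" where
  "initial_segment w V \<longleftrightarrow> occurs_at w V 0"

definition recurrent :: "bit word \<Rightarrow> bool" where
  "recurrent V \<longleftrightarrow> (\<forall>w. subword w V \<longrightarrow> infinite {n. occurs_at w V n})"

definition balanced :: "bit word \<Rightarrow> bool" where
  "balanced V \<longleftrightarrow> (\<forall>u w. subword u V \<and> subword w V \<and> length u = length w
     \<longrightarrow> \<bar>int (count_list u 1) - int (count_list w 1)\<bar> \<le> 1)"

definition eventually_periodic :: "bit word \<Rightarrow> bool" where
  "eventually_periodic V \<longleftrightarrow> (\<exists>u v. v \<noteq> [] \<and> V = u \<frown> v\<^sup>\<omega>)"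

definition zero_bounded_words :: "bit list set"  (\<open>\<F>\<close>) where
  "\<F> = {w. w \<noteq> [] \<and> hd w = 0 \<and> last w = 0}"

text \<open>
  \<open>is_building S w vs as\<close>: with \<open>vs = [v\<^sub>1, \<dots>, v\<^sub>k\<^sub>+\<^sub>1]\<close> and \<open>as = [a\<^sub>1, \<dots>, a\<^sub>k]\<close>, the expression
  \<open>v\<^sub>1 1\<^sup>a\<^sup>1 v\<^sub>2 1\<^sup>a\<^sup>2 \<dots> v\<^sub>k 1\<^sup>a\<^sup>k v\<^sub>k\<^sub>+\<^sub>1\<close> is a building of \<open>w\<close> from \<open>S\<close>.
\<close>

definition is_building ::
    "bit list set \<Rightarrow> bit list \<Rightarrow> bit list list \<Rightarrow> nat list \<Rightarrow> bool" where
  "is_building S w vs as \<longleftrightarrow>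
     length as \<ge> 1 \<and> length vs = length as + 1 \<and> set vs \<subseteq> S \<and>
     w = concat (map (\<lambda>(v, a). v @ replicate a 1) (zip (butlast vs) as)) @ last vs"

definition built_from :: "bit list \<Rightarrow> bit list set \<Rightarrow> bool" where
  "built_from w S \<longleftrightarrow> (\<exists>vs as. is_building S w vs as)"

definition rank_one_construction :: "bit word \<Rightarrow> bool" where
  "rank_one_construction V \<longleftrightarrow>
     (\<exists>v :: nat \<Rightarrow> bit list.
        (\<forall>i. v i \<in> \<F>) \<and> v 0 = [0] \<and>
        (\<forall>i. built_from (v (Suc i)) {v i}) \<and>
        (\<forall>i. initial_segment (v i) V))"

text \<open>
  The requirements on the first word and on the words used are imposed on one and the same building.
\<close>

definition proper_rank_two_construction :: "bit word \<Rightarrow> bool" where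
  "proper_rank_two_construction V \<longleftrightarrow>
     \<not> rank_one_construction V \<and>
     (\<exists>(S :: nat \<Rightarrow> bit list set) (v1 :: nat \<Rightarrow> bit list) (v2 :: nat \<Rightarrow> bit list).
        S 0 = {[0]} \<and> v1 0 = [0] \<and> v2 0 = [0] \<and>
        (\<forall>i\<ge>1. S i = {v1 i, v2 i} \<and> v1 i \<noteq> v2 i \<and> S i \<subseteq> \<F>) \<and>
        (\<forall>i. (\<exists>vs as. is_building (S i) (v1 (Suc i)) vs as \<and> hd vs = v1 i \<and> set vs = S i) \<and>
             (\<exists>vs as. is_building (S i) (v2 (Suc i)) vs as \<and> set vs = S i)) \<and>
        (\<forall>i. initial_segment (v1 i) V))"

end

theory Submission
  imports Defs "HOL-Library.Sublist"
begin

text \<open>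
  The gaps between consecutive occurrences of an isolated letter in a balanced, aperiodic sequence
  take two values, and the sequence of gaps is again balanced and aperiodic. Hence \<open>V\<close> can be
  desubstituted again and again: at every stage it is an infinite product of two words \<open>W True\<close> and
  \<open>W False\<close>, and each of the two words of the next stage is a product in which both words of the
  present stage occur. Removing the trailing 1s of these words, which serve as the spacers, gives
  the sets of a rank-two construction.

  A rank-one construction would give, for arbitrarily large \<open>q\<close>, a block of \<open>q - 1\<close> gaps that is
  repeated forever, separated by single gaps that take both values. If \<open>A\<close> is the isolated value,
  a separator equal to \<open>A\<close> is preceded by \<open>A B\<^sup>t\<close> with \<open>t \<ge> 1\<close> and followed by \<open>B\<close>; replacing this
  separator by \<open>B\<close> gives a factor \<open>B\<^sup>t\<^sup>+\<^sup>2\<close>, which together with \<open>A B\<^sup>t A\<close> contradicts balance.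
\<close>

section \<open>Balanced sequences\<close>

definition cnt :: "(nat \<Rightarrow> bool) \<Rightarrow> nat \<Rightarrow> nat \<Rightarrow> nat" where
  "cnt f i n = card {x \<in> {i..<i + n}. f x}"

text \<open>One inequality replaces the absolute value, since \<open>i\<close> and \<open>j\<close>
  may be exchanged.\<close>

definition bal :: "(nat \<Rightarrow> bool) \<Rightarrow> bool" where
  "bal f \<longleftrightarrow> (\<forall>i j n. cnt f i n \<le> cnt f j n + 1)"

definition ev_per :: "(nat \<Rightarrow> 'a) \<Rightarrow> bool" where
  "ev_per f \<longleftrightarrow> (\<exists>N q. q > 0 \<and> (\<forall>n\<ge>N. f (n + q) = f n))"

text \<open>For nonempty words \<open>W c\<close> this says that \<open>V\<close> is the infinite
  product \<open>W (f 0) W (f 1) ...\<close>. Using finite partial products avoids infinite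
  concatenation.\<close>

definition coded :: "('a \<Rightarrow> 'b list) \<Rightarrow> (nat \<Rightarrow> 'a) \<Rightarrow> (nat \<Rightarrow> 'b) \<Rightarrow> bool" where
  "coded W f V \<longleftrightarrow> (\<forall>n. \<exists>m. concat (map W (map f [0..<n])) = map V [0..<m])"

lemma cnt_mono: "m \<le> n \<Longrightarrow> cnt f i m \<le> cnt f i n"
  unfolding cnt_def by (rule card_mono) auto

lemma cnt_0 [simp]: "cnt f i 0 = 0"
  by (simp add: cnt_def)

lemma cnt_Suc: "cnt f i (Suc n) = cnt f i n + of_bool (f (i + n))"
proof -
  have "{x \<in> {i..<i + Suc n}. f x} =
      (if f (i + n) then insert (i + n) {x \<in> {i..<i + n}. f x} else {x \<in> {i..<i + n}. f x})"
    by (auto simp: less_Suc_eq)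
  then show ?thesis
    by (simp add: cnt_def)
qed

lemma cnt_compl: "cnt f i n + cnt (\<lambda>x. \<not> f x) i n = n"
  by (induction n) (auto simp: cnt_Suc)

lemma bal_compl:
  assumes "bal f"
  shows "bal (\<lambda>x. \<not> f x)"
  unfolding bal_def
proof (intro allI)
  fix i j n
  have "cnt f j n \<le> cnt f i n + 1"
    using assms by (simp add: bal_def)
  then show "cnt (\<lambda>x. \<not> f x) i n \<le> cnt (\<lambda>x. \<not> f x) j n + 1"
    using cnt_compl[of f i n] cnt_compl[of f j n] by linarith
qed

lemma bal_letter:
  assumes "bal f"
  shows "bal (\<lambda>x. f x = A)"
  using assms bal_compl[OF assms] by (cases A) auto

lemma ev_per_letter:
  assumes "ev_per (\<lambda>x. f x = A)"
  shows "ev_per (f :: nat \<Rightarrow> bool)"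
proof -
  obtain N q where "q > 0" and q: "\<And>n. n \<ge> N \<Longrightarrow> (f (n + q) = A) = (f n = A)"
    using assms unfolding ev_per_def by blast
  moreover have "f (n + q) = f n" if "n \<ge> N" for n
    using q[OF that] by (cases A) auto
  ultimately show ?thesis
    unfolding ev_per_def by blast
qed

lemma infinite_letter:
  assumes "\<not> ev_per f"
  shows "infinite {x. f x}"
proof
  assume "finite {x. f x}"
  then obtain N where N: "\<And>x. f x \<Longrightarrow> x < N"
    by (metis finite_nat_set_iff_bounded mem_Collect_eq)
  then have "\<forall>n\<ge>N. f (n + 1) = f n"
    by (metis le_add1 le_trans not_le)
  then show False
    using assms unfolding ev_per_def by (metis zero_less_one)
qed

text \<open>Otherwise two windows of length 2, one with two occurrences of \<open>True\<close> and
  one with none, would contradict balance.\<close>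

lemma isolated_letter:
  assumes "bal f"
  obtains A where "\<And>x. \<not> (f x = A \<and> f (Suc x) = A)"
proof (cases "\<exists>x. f x \<and> f (Suc x)")
  case False
  then show ?thesis
    using that[of True] by blast
next
  case True
  then obtain x where x: "f x" "f (Suc x)"
    by blast
  have "\<not> (\<not> f y \<and> \<not> f (Suc y))" for y
  proof
    assume y: "\<not> f y \<and> \<not> f (Suc y)"
    have "cnt f x (Suc (Suc 0)) = 2" "cnt f y (Suc (Suc 0)) = 0"
      using x y by (auto simp: cnt_Suc)
    moreover have "cnt f x (Suc (Suc 0)) \<le> cnt f y (Suc (Suc 0)) + 1"
      using assms unfolding bal_def by blast
    ultimately show False
      by simp
  qed
  then show ?thesis
    using that[of False] by blast
qed

section \<open>The sequence of gaps between occurrences of a letter\<close>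

lemma upt_append: "a \<le> b \<Longrightarrow> b \<le> c \<Longrightarrow> [a..<b] @ [b..<c] = [a..<c]"
  using upt_add_eq_append[of a b "c - b"] by simp

lemma prefix_of_map_upt:
  assumes "xs @ ys = map g [0..<m]"
  shows "\<exists>l. xs = map g [0..<l]"
proof -
  have "xs = take (length xs) (map g [0..<m])"
    by (simp flip: assms)
  also have "\<dots> = map g [0..<min (length xs) m]"
    by (simp add: take_map min_def)
  finally show ?thesis ..
qed

text \<open>Applied at each stage to the positions of an isolated letter, and once to the zeros of
  \<open>V\<close>, where 0 need not be isolated.\<close>

locale gaps =
  fixes g :: "nat \<Rightarrow> bool" and p :: "nat \<Rightarrow> nat"
  assumes bal: "bal g"
    and aperiodic: "\<not> ev_per g"
    and p_def: "p = enumerate {x. g x}"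
begin

lemma p_mono: "strict_mono p"
  unfolding p_def using infinite_letter[OF aperiodic] strict_mono_enumerate by blast

lemma p_less_iff: "p i < p j \<longleftrightarrow> i < j"
  by (rule strict_mono_less[OF p_mono])

lemma p_le_iff: "p i \<le> p j \<longleftrightarrow> i \<le> j"
  by (rule strict_mono_less_eq[OF p_mono])

lemma g_iff: "g x \<longleftrightarrow> x \<in> range p"
  unfolding p_def using range_enumerate[OF infinite_letter[OF aperiodic]] by blast

lemma cnt_eq:
  assumes "\<And>j. a \<le> p j \<and> p j < a + n \<longleftrightarrow> i \<le> j \<and> j < i + k"
  shows "cnt g a n = k"
proof -
  have "{x \<in> {a..<a + n}. g x} = p ` {i..<i + k}"
  proof (rule set_eqI)
    fix x
    show "x \<in> {x \<in> {a..<a + n}. g x} \<longleftrightarrow> x \<in> p ` {i..<i + k}"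
      unfolding g_iff mem_Collect_eq atLeastLessThan_iff image_iff Bex_def using assms by blast
  qed
  moreover have "inj_on p {i..<i + k}"
    by (rule inj_on_subset[OF strict_mono_imp_inj_on[OF p_mono] subset_UNIV])
  ultimately show ?thesis
    by (simp add: cnt_def card_image)
qed

lemma cnt_closed: "cnt g (p i) (Suc (p (i + k) - p i)) = Suc k"
proof (rule cnt_eq)
  fix j
  have "p i \<le> p (i + k)"
    by (simp add: p_le_iff)
  then have "p j < p i + Suc (p (i + k) - p i) \<longleftrightarrow> p j \<le> p (i + k)"
    by auto
  then show "p i \<le> p j \<and> p j < p i + Suc (p (i + k) - p i) \<longleftrightarrow> i \<le> j \<and> j < i + Suc k"
    by (auto simp: p_le_iff)
qed

text \<open>If the \<open>k\<close> gaps after \<open>p i\<close> exceeded those after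
  \<open>p j\<close> in total by 2 or more, the open interval between \<open>p i\<close> and
  \<open>p (i + k)\<close>, with \<open>k - 1\<close> marks, would be at least as long as the closed
  interval from \<open>p j\<close> to \<open>p (j + k)\<close>, with \<open>k + 1\<close>
  marks.\<close>

lemma p_bal: "p (i + k) + p j \<le> p (j + k) + p i + 1"
proof (rule ccontr)
  assume less: "\<not> p (i + k) + p j \<le> p (j + k) + p i + 1"
  obtain l where k: "k = Suc l"
    using less by (cases k) auto
  have "cnt g (Suc (p i)) (p (i + k) - p i - 1) = l"
  proof (rule cnt_eq)
    fix y
    have "p i < p (i + k)"
      by (simp add: p_less_iff k)
    then have "p y < Suc (p i) + (p (i + k) - p i - 1) \<longleftrightarrow> p y < p (i + k)"
      by auto
    then show "Suc (p i) \<le> p y \<and> p y < Suc (p i) + (p (i + k) - p i - 1)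
        \<longleftrightarrow> Suc i \<le> y \<and> y < Suc i + l"
      by (auto simp: p_less_iff k Suc_le_eq)
  qed
  moreover have "Suc (p (j + k) - p j) \<le> p (i + k) - p i - 1"
    using less p_le_iff[of i "i + k"] p_le_iff[of j "j + k"] by simp
  ultimately have "cnt g (Suc (p i)) (Suc (p (j + k) - p j)) \<le> l"
    by (metis cnt_mono)
  moreover have "cnt g (p j) (Suc (p (j + k) - p j)) = Suc k"
    by (rule cnt_closed)
  moreover have "cnt g (p j) n \<le> cnt g (Suc (p i)) n + 1" for n
    using bal unfolding bal_def by blast
  ultimately show False
    using k by (metis Suc_eq_plus1 Suc_le_mono le_trans not_less_eq_eq)
qed

text \<open>The initial run behaves like a gap that may be too short, but not too long.\<close>

lemma p_bal_initial: "p k + p j \<le> p (Suc (j + k))"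
proof (rule ccontr)
  assume less: "\<not> p k + p j \<le> p (Suc (j + k))"
  have "cnt g 0 (p k) = k"
    by (rule cnt_eq[where i = 0]) (auto simp: p_less_iff)
  moreover have "Suc (p (j + Suc k) - p j) \<le> p k"
    using less p_le_iff[of j "j + Suc k"] by simp
  ultimately have "cnt g 0 (Suc (p (j + Suc k) - p j)) \<le> k"
    by (metis cnt_mono)
  moreover have "cnt g (p j) (Suc (p (j + Suc k) - p j)) = Suc (Suc k)"
    by (rule cnt_closed)
  moreover have "cnt g (p j) n \<le> cnt g 0 n + 1" for n
    using bal unfolding bal_def by blast
  ultimately show False
    by (metis Suc_eq_plus1 Suc_le_mono le_trans not_less_eq_eq)
qed

definition R :: nat where
  "R = (LEAST n. \<exists>i. n = p (Suc i) - p i - 1)"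

definition gap :: "nat \<Rightarrow> bool" where
  "gap i \<longleftrightarrow> p (Suc i) \<noteq> p i + R + 1"

lemma R_attained: "\<exists>i. p (Suc i) = p i + R + 1"
proof -
  have "\<exists>i. R = p (Suc i) - p i - 1"
    unfolding R_def by (rule LeastI_ex) blast
  then show ?thesis
    using p_less_iff by (metis Suc_diff_Suc Suc_eq_plus1 add_diff_inverse_nat diff_Suc_1 less_imp_not_less lessI add.assoc)
qed

text \<open>By \<open>p_bal\<close> with \<open>k = 1\<close> no gap exceeds the shortest one by
  more than 1, so the Boolean \<open>gap i\<close> records the gap completely.\<close>

lemma p_Suc: "p (Suc i) = p i + R + 1 + of_bool (gap i)"
proof -
  obtain j where j: "p (Suc j) = p j + R + 1"
    using R_attained by blast
  have "p (Suc i) \<le> p i + R + 2"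
    using p_bal[of i 1 j] j by simp
  moreover have "R \<le> p (Suc i) - p i - 1"
    unfolding R_def by (rule Least_le) blast
  moreover have "p i < p (Suc i)"
    by (simp add: p_less_iff)
  ultimately show ?thesis
    by (auto simp: gap_def)
qed

lemma p_0_le: "p 0 \<le> R + 1"
proof -
  obtain j where "p (Suc j) = p j + R + 1"
    using R_attained by blast
  then show ?thesis
    using p_bal_initial[of 0 j] by simp
qed

text \<open>A stretch of \<open>k\<close> blocks has length \<open>k * (R + 1)\<close> plus its
  number of long blocks, so comparing lengths compares these numbers. The boundaries
  \<open>b\<close> are kept abstract because they are \<open>p\<close> in one use and a shifted
  version of \<open>p\<close> in the other.\<close>

lemma bal_of_boundaries:
  assumes step: "\<And>i. b (Suc i) = b i + R + 1 + of_bool (h i)"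
    and b: "\<And>i j k. b (i + k) + b j \<le> b (j + k) + b i + (1 :: nat)"
  shows "bal h"
proof -
  have cnt: "b (i + k) = b i + k * (R + 1) + cnt h i k" for i k
    by (induction k) (auto simp: step cnt_Suc)
  have "cnt h i n \<le> cnt h j n + 1" for i j n
    using b[of i n j] cnt[of i n] cnt[of j n] by linarith
  then show ?thesis
    by (simp add: bal_def)
qed

lemma bal_gap: "bal gap"
  by (rule bal_of_boundaries[OF p_Suc p_bal])

text \<open>If the gaps had eventual period \<open>q\<close>, shifting by the total length
  \<open>P\<close> of \<open>q\<close> consecutive gaps would preserve the marks from some point
  on.\<close>

lemma aperiodic_gap: "\<not> ev_per gap"
proof
  assume "ev_per gap"
  then obtain N q where "q > 0" and q: "\<And>n. n \<ge> N \<Longrightarrow> gap (n + q) = gap n"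
    unfolding ev_per_def by blast
  define P where "P = p (N + q) - p N"
  have P: "p (N + q) = p N + P" "P > 0"
    using p_less_iff[of N "N + q"] \<open>q > 0\<close> unfolding P_def by auto
  have shift: "p (N + k + q) = p (N + k) + P" for k
  proof (induction k)
    case (Suc k)
    have "p (N + Suc k + q) = p (N + k + q) + R + 1 + of_bool (gap (N + k + q))"
      using p_Suc[of "N + k + q"] by simp
    then show ?case
      using Suc p_Suc[of "N + k"] q[of "N + k"] by simp
  qed (simp add: P)
  have "g (x + P) = g x" if x: "x \<ge> p N" for x
  proof
    assume "g (x + P)"
    then obtain j where j: "x + P = p j"
      by (auto simp: g_iff)
    then have "p (N + q) \<le> p j"
      using P x by simp
    then obtain k where "j = N + k + q"
      unfolding p_le_iff by (metis add.assoc add.commute nat_le_iff_add)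
    then show "g x"
      using shift[of k] j by (simp add: g_iff)
  next
    assume "g x"
    then obtain j where j: "x = p j"
      by (auto simp: g_iff)
    then obtain k where "j = N + k"
      using x p_le_iff le_Suc_ex by blast
    then show "g (x + P)"
      using shift[of k] j by (metis g_iff rangeI)
  qed
  then show False
    using aperiodic P(2) unfolding ev_per_def by blast
qed

lemma map_g_initial: "map g [0..<p 0] = replicate (p 0) False"
proof -
  have "\<not> g x" if "x < p 0" for x
    using that p_le_iff by (auto simp: g_iff not_le[symmetric])
  then show ?thesis
    by (intro nth_equalityI) auto
qed

lemma map_g_between:
  "map g [Suc (p i)..<p (Suc i)] = replicate (R + of_bool (gap i)) False"
proof -
  have "\<not> g x" if "p i < x" "x < p (Suc i)" for x
    using that p_less_iff by (auto simp: g_iff)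
  then show ?thesis
    using p_Suc[of i] by (intro nth_equalityI) (auto simp del: upt_Suc)
qed

lemma g_p: "g (p i)"
  by (simp add: g_iff)

text \<open>
  The product of the words of the next stage has to start exactly at the beginning of \<open>g\<close>, so the
  blocks are cut at the distance \<open>p 0\<close> before each occurrence of the letter. This is impossible if
  \<open>p 0 = R + 1\<close>; in that case the initial run is itself a complete gap, and the blocks are cut
  immediately after the occurrences.
\<close>

definition code_mid :: "bool \<Rightarrow> bool list" where
  "code_mid b = replicate (p 0) False @ True # replicate (R + of_bool b - p 0) False"

lemma coded_mid:
  assumes "p 0 \<le> R"
  shows "coded code_mid gap g"
  unfolding coded_def
proof
  fix n
  have *: "code_mid b @ replicate (p 0) False
      = replicate (p 0) False @ True # replicate (R + of_bool b) False" for b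
    using assms by (auto simp: code_mid_def simp flip: replicate_add)
  \<comment> \<open>The first \<open>n\<close> blocks end \<open>p 0\<close> positions before the
    mark \<open>p n\<close>. Appending these positions gives an invariant that ends at a mark; they
    are removed again afterwards.\<close>
  have "concat (map code_mid (map gap [0..<n])) @ replicate (p 0) False = map g [0..<p n]"
  proof (induction n)
    case (Suc n)
    have "p n < p (Suc n)"
      by (simp add: p_less_iff)
    then have "[0..<p (Suc n)] = [0..<p n] @ p n # [Suc (p n)..<p (Suc n)]"
      by (metis less_imp_le_nat upt_append upt_conv_Cons zero_le)
    then show ?case
      using Suc[symmetric] * by (simp add: g_p map_g_between)
  qed (simp add: map_g_initial)
  then show "\<exists>m. concat (map code_mid (map gap [0..<n])) = map g [0..<m]"
    by (rule prefix_of_map_upt)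
qed

definition code_end :: "bool \<Rightarrow> bool list" where
  "code_end b = replicate (R + of_bool b) False @ [True]"

text \<open>The value at 0 is \<open>True\<close> because the initial run, of length
  \<open>R + 1\<close> in this case, counts as a long gap.\<close>

definition gap_end :: "nat \<Rightarrow> bool" where
  "gap_end i = (case i of 0 \<Rightarrow> True | Suc j \<Rightarrow> gap j)"

lemma coded_end:
  assumes "p 0 = R + 1"
  shows "coded code_end gap_end g"
  unfolding coded_def
proof
  fix n
  have "concat (map code_end (map gap_end [0..<Suc n])) = map g [0..<Suc (p n)]" for n
  proof (induction n)
    case 0
    then show ?case
      using assms map_g_initial g_p[of 0] by (simp add: code_end_def gap_end_def)
  next
    case (Suc n)
    have "Suc (p n) \<le> p (Suc n)"
      by (simp add: p_less_iff Suc_le_eq)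
    then have "[0..<Suc (p (Suc n))] = [0..<Suc (p n)] @ [Suc (p n)..<p (Suc n)] @ [p (Suc n)]"
      using upt_append[of 0 "Suc (p n)" "p (Suc n)"] upt_Suc_append[of 0 "p (Suc n)"]
      by (metis append_assoc zero_le)
    moreover have "map gap_end [0..<Suc (Suc n)] = map gap_end [0..<Suc n] @ [gap n]"
      by (simp add: gap_end_def)
    ultimately show ?case
      using Suc by (simp add: g_p map_g_between code_end_def del: upt_Suc)
  qed
  then show "\<exists>m. concat (map code_end (map gap_end [0..<n])) = map g [0..<m]"
    by (cases n) (auto intro: exI[of _ 0] simp del: upt_Suc)
qed

text \<open>The boundaries are 0 and the positions just after the marks. Comparisons with a stretch
  that starts at 0 need \<open>p_bal_initial\<close> in one direction; in the other, one gap is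
  split off and bounded by \<open>R + 2 = p 0 + 1\<close>.\<close>

lemma bal_gap_end:
  assumes "p 0 = R + 1"
  shows "bal gap_end"
proof -
  define b where "b i = (case i of 0 \<Rightarrow> 0 | Suc j \<Rightarrow> Suc (p j))" for i
  have "b (Suc i) = b i + R + 1 + of_bool (gap_end i)" for i
    using assms p_Suc by (auto simp: b_def gap_end_def split: nat.split)
  moreover have "b (i + k) + b j \<le> b (j + k) + b i + 1" for i j k
  proof (cases k)
    case (Suc l)
    show ?thesis
    proof (cases i; cases j)
      fix j' assume "i = 0" "j = Suc j'"
      then show ?thesis
        using p_bal_initial[of l j'] Suc by (simp add: b_def)
    next
      fix i' assume "i = Suc i'" "j = 0"
      moreover have "p (Suc (i' + l)) \<le> p (i' + l) + R + 2"
        using p_Suc[of "i' + l"] by simp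
      moreover have "p (i' + l) + p 0 \<le> p l + p i' + 1"
        using p_bal[of i' l 0] by simp
      ultimately show ?thesis
        using assms Suc by (simp add: b_def)
    next
      fix i' j' assume "i = Suc i'" "j = Suc j'"
      then show ?thesis
        using p_bal[of i' k j'] by (simp add: b_def)
    qed simp
  qed simp
  ultimately show ?thesis
    by (rule bal_of_boundaries)
qed

lemma aperiodic_gap_end: "\<not> ev_per gap_end"
proof
  assume "ev_per gap_end"
  then obtain N q where q: "q > 0" "\<And>n. n \<ge> N \<Longrightarrow> gap_end (n + q) = gap_end n"
    unfolding ev_per_def by blast
  have "gap (n + q) = gap n" if "n \<ge> N" for n
    using q(2)[of "Suc n"] that by (simp add: gap_end_def)
  then show False
    using aperiodic_gap q(1) unfolding ev_per_def by blast
qed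

end

section \<open>Desubstitution of a sequence and the first coding of \<open>V\<close>\<close>

lemma coded_map:
  assumes "coded W f g"
  shows "coded (\<lambda>b. map h (W b)) f (\<lambda>x. h (g x))"
  unfolding coded_def
proof
  fix n
  obtain m where m: "concat (map W (map f [0..<n])) = map g [0..<m]"
    using assms unfolding coded_def by blast
  have "concat (map (\<lambda>b. map h (W b)) xs) = map h (concat (map W xs))" for xs
    by (induction xs) auto
  then have "concat (map (\<lambda>b. map h (W b)) (map f [0..<n])) = map h (concat (map W (map f [0..<n])))" .
  also have "\<dots> = map (\<lambda>x. h (g x)) [0..<m]"
    unfolding m by simp
  finally show "\<exists>m. concat (map (\<lambda>b. map h (W b)) (map f [0..<n])) = map (\<lambda>x. h (g x)) [0..<m]"
    by (rule exI)
qed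

lemma coded_compose:
  assumes "coded W f V" and "coded code f' f"
  shows "coded (\<lambda>b. concat (map W (code b))) f' V"
proof -
  have "concat (map (\<lambda>b. concat (map W (code b))) xs) = concat (map W (concat (map code xs)))" for xs
    by (induction xs) auto
  then show ?thesis
    using assms unfolding coded_def by metis
qed

text \<open>The two code words differ in content by one additional letter other than
  \<open>A\<close>, so every positive weight \<open>h\<close> separates them. This form is needed
  because the words substituted for the two letters may coincide, as they do at the initial stage;
  the weight will be the number of zeros.\<close>

lemma derived_sequence:
  fixes f :: "nat \<Rightarrow> bool"
  assumes "bal f" and "\<not> ev_per f"
  obtains code f' where "bal f'" "\<not> ev_per f'" "coded code f' f" "\<And>b. set (code b) = UNIV"
    "\<And>h :: bool \<Rightarrow> nat. (\<And>c. h c > 0) \<Longrightarrow>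
       sum_list (map h (code True)) \<noteq> sum_list (map h (code False))"
proof -
  obtain A where A: "\<And>x. \<not> (f x = A \<and> f (Suc x) = A)"
    using isolated_letter[OF assms(1)] by blast
  define g where "g = (\<lambda>x. f x = A)"
  define p where "p = enumerate {x. g x}"
  interpret gaps g p
    using bal_letter[OF assms(1)] ev_per_letter assms(2)
    by unfold_locales (auto simp: g_def p_def)
  have f: "f = (\<lambda>x. g x = A)"
    by (auto simp: g_def)
  \<comment> \<open>Adjacent marks are excluded by the choice of \<open>A\<close>; hence each code
    word also contains the other letter.\<close>
  have "R \<ge> 1"
  proof (rule ccontr)
    assume "\<not> R \<ge> 1"
    then have "R = 0"
      by simp
    then obtain i where "p (Suc i) = Suc (p i)"
      using R_attained by auto
    then show False
      using A[of "p i"] g_p[of i] g_p[of "Suc i"] by (simp add: g_def)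
  qed
  show ?thesis
  proof (cases "p 0 \<le> R")
    case True
    show ?thesis
    proof (rule that)
      show "bal gap" "\<not> ev_per gap"
        by (rule bal_gap aperiodic_gap)+
      show "coded (\<lambda>b. map (\<lambda>y. y = A) (code_mid b)) gap f"
        unfolding f by (rule coded_map[OF coded_mid[OF True]])
      show "set (map (\<lambda>y. y = A) (code_mid b)) = UNIV" for b
        using \<open>R \<ge> 1\<close> True by (cases "p 0 = 0") (auto simp: code_mid_def UNIV_bool)
      show "sum_list (map h (map (\<lambda>y. y = A) (code_mid True)))
          \<noteq> sum_list (map h (map (\<lambda>y. y = A) (code_mid False)))"
        if "\<And>c. h c > 0" for h :: "bool \<Rightarrow> nat"
        using that[of "False = A"] True by (simp add: code_mid_def sum_list_replicate Suc_diff_le)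
    qed
  next
    case False
    then have p0: "p 0 = R + 1"
      using p_0_le by simp
    show ?thesis
    proof (rule that)
      show "bal gap_end" "\<not> ev_per gap_end"
        by (rule bal_gap_end[OF p0] aperiodic_gap_end)+
      show "coded (\<lambda>b. map (\<lambda>y. y = A) (code_end b)) gap_end f"
        unfolding f by (rule coded_map[OF coded_end[OF p0]])
      show "set (map (\<lambda>y. y = A) (code_end b)) = UNIV" for b
        using \<open>R \<ge> 1\<close> by (auto simp: code_end_def UNIV_bool)
      show "sum_list (map h (map (\<lambda>y. y = A) (code_end True)))
          \<noteq> sum_list (map h (map (\<lambda>y. y = A) (code_end False)))"
        if "\<And>c. h c > 0" for h :: "bool \<Rightarrow> nat"
        using that[of "False = A"] by (simp add: code_end_def sum_list_replicate)
    qed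
  qed
qed

text \<open>Cutting \<open>V\<close> before each 0 leaves no initial run, since
  \<open>V 0 = 0\<close>; the blocks are then a 0 followed by \<open>R\<close> or
  \<open>R + 1\<close> letters 1.\<close>

lemma initial_coding:
  fixes V :: "bit word"
  assumes "balanced V" and "\<not> eventually_periodic V" and "V 0 = 0"
  obtains R f where "bal f" "\<not> ev_per f"
    "coded (\<lambda>b. 0 # replicate (R + of_bool b) 1) f V"
proof -
  have cnt: "cnt (\<lambda>x. V x = 1) i n = count_list (V [i \<rightarrow> i + n]) 1" for i n
    by (induction n) (simp_all add: cnt_Suc subsequence_def)
  have subword: "subword (V [i \<rightarrow> i + n]) V" for i n
    unfolding subword_def occurs_at_def by (rule exI[of _ i]) simp
  have "cnt (\<lambda>x. V x = 1) i n \<le> cnt (\<lambda>x. V x = 1) j n + 1" for i j n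
  proof -
    have "\<bar>int (count_list (V [i \<rightarrow> i + n]) 1) - int (count_list (V [j \<rightarrow> j + n]) 1)\<bar> \<le> 1"
      using assms(1) subword unfolding balanced_def by simp
    then show ?thesis
      unfolding cnt by linarith
  qed
  then have "bal (\<lambda>x. V x = 1)"
    by (simp add: bal_def)
  then have "bal (\<lambda>x. \<not> V x = 1)"
    by (rule bal_compl)
  then have bal: "bal (\<lambda>x. V x = 0)"
    by simp
  have aperiodic: "\<not> ev_per (\<lambda>x. V x = 0)"
  proof
    assume "ev_per (\<lambda>x. V x = 0)"
    then obtain N q where "q > 0" and q: "\<And>n. n \<ge> N \<Longrightarrow> (V (n + q) = 0) = (V n = 0)"
      unfolding ev_per_def by blast
    have q: "V (n + q) = V n" if "n \<ge> N" for n
      using q[OF that] by (metis bit_not_zero_iff)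
    \<comment> \<open>Reduction modulo \<open>q\<close> turns the eventual period into an expression
      with an omega power.\<close>
    have "V (N + n) = V (N + n mod q)" for n
    proof (induction n rule: less_induct)
      case (less n)
      show ?case
      proof (cases "n < q")
        case False
        then have "V (N + n) = V (N + (n - q))"
          using q[of "N + (n - q)"] by simp
        then show ?thesis
          using less[of "n - q"] False \<open>q > 0\<close> by (simp add: le_mod_geq)
      qed simp
    qed
    then have "V = V [0 \<rightarrow> N] \<frown> (V [N \<rightarrow> N + q])\<^sup>\<omega>"
      using \<open>q > 0\<close> by (intro ext) (auto simp: conc_def not_less dest!: le_Suc_ex)
    moreover have "V [N \<rightarrow> N + q] \<noteq> []"
      using \<open>q > 0\<close> by simp
    ultimately show False
      using assms(2) unfolding eventually_periodic_def by blast
  qed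
  define p where "p = enumerate {x. V x = 0}"
  interpret gaps "\<lambda>x. V x = 0" p
    using bal aperiodic by unfold_locales (simp_all add: p_def)
  have p0: "p 0 = 0"
    unfolding p_def enumerate_0 by (rule Least_equality) (use assms(3) in auto)
  have V: "(\<lambda>x. if V x = 0 then 0 else 1) = V"
    by (auto simp: fun_eq_iff)
  have "p 0 \<le> R"
    by (simp add: p0)
  from coded_map[OF coded_mid[OF this], of "\<lambda>y. if y then 0 else 1 :: bit"]
  have "coded (\<lambda>b. map (\<lambda>y. if y then 0 else 1) (code_mid b)) gap V"
    unfolding V .
  then have "coded (\<lambda>b. 0 # replicate (R + of_bool b) 1) gap V"
    by (simp add: code_mid_def p0)
  then show ?thesis
    using that bal_gap aperiodic_gap by blast
qed

section \<open>No rank-one construction\<close>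

text \<open>The positions \<open>x\<close> with \<open>q dvd Suc x\<close> are the separators;
  between them the block \<open>f 0, ..., f (q - 2)\<close> is repeated.\<close>

lemma bal_no_fixed_return:
  fixes f :: "nat \<Rightarrow> bool"
  assumes "bal f" and "\<not> ev_per f"
    and returns: "\<And>M. \<exists>q>M. \<forall>x. \<not> q dvd Suc x \<longrightarrow> f x = f (x mod q)"
  shows False
proof -
  obtain A where A: "\<And>x. \<not> (f x = A \<and> f (Suc x) = A)"
    using isolated_letter[OF assms(1)] by blast
  have "infinite {x. f x = A}"
    using infinite_letter[of "\<lambda>x. f x = A"] ev_per_letter assms(2) by blast
  then obtain x0 where x0: "f x0 = A"
    using not_finite_existsD by blast
  \<comment> \<open>This bound puts \<open>x0\<close> below \<open>q - 1\<close>, so the repeated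
    block contains an \<open>A\<close>.\<close>
  obtain q where "q > Suc x0" and q: "\<And>x. \<not> q dvd Suc x \<Longrightarrow> f x = f (x mod q)"
    using returns by blast
  \<comment> \<open>With equal separators the whole sequence would have period
    \<open>q\<close>.\<close>
  have not_const: "\<exists>n. q dvd Suc n \<and> f n \<noteq> B" for B
  proof (rule ccontr)
    assume const: "\<nexists>n. q dvd Suc n \<and> f n \<noteq> B"
    have "f (n + q) = f n" for n
    proof (cases "q dvd Suc n")
      case True
      moreover from this have "q dvd Suc (n + q)"
        by (metis add_Suc dvd_add_triv_right_iff)
      ultimately show ?thesis
        using const by blast
    next
      case False
      moreover from this have "\<not> q dvd Suc (n + q)"
        by (metis add_Suc dvd_add_triv_right_iff)
      ultimately show ?thesis
        using q[of n] q[of "n + q"] by simp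
    qed
    moreover have "q > 0"
      using \<open>q > Suc x0\<close> by simp
    ultimately show False
      using assms(2) unfolding ev_per_def by blast
  qed
  obtain n1 where n1: "q dvd Suc n1" "f n1 = A"
    using not_const[of "\<not> A"] by auto
  obtain n2 where n2: "q dvd Suc n2" "f n2 \<noteq> A"
    using not_const[of A] by auto
  have before: "f (n - d) = f (q - 1 - d)" "q \<le> Suc n" if "q dvd Suc n" "0 < d" "d < q" for n d
  proof -
    obtain k where "Suc n = q * Suc k"
      using \<open>q dvd Suc n\<close> by (metis dvdE mult_0_right nat.distinct(1) not0_implies_Suc)
    then have *: "n - d = q * k + (q - 1 - d)" "Suc (n - d) = q * k + (q - d)"
      using that by simp_all
    have mod: "(q * k + r) mod q = r" if "r < q" for r
      using that by simp
    have "(n - d) mod q = q - 1 - d"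
      unfolding *(1) by (rule mod) (use that in simp)
    moreover have "Suc (n - d) mod q = q - d"
      unfolding *(2) by (rule mod) (use that in simp)
    ultimately show "f (n - d) = f (q - 1 - d)"
      using q[of "n - d"] that by (simp add: dvd_eq_mod_eq_0)
    show "q \<le> Suc n"
      using \<open>q dvd Suc n\<close> by (simp add: dvd_imp_le)
  qed
  have after: "f (Suc n) = f 0" if "q dvd Suc n" for n
  proof -
    have "Suc n mod q = 0"
      using that by simp
    moreover from this have "\<not> q dvd Suc (Suc n)"
      using \<open>q > Suc x0\<close> by (simp add: dvd_eq_mod_eq_0 mod_Suc)
    ultimately show ?thesis
      using q[of "Suc n"] by simp
  qed
  \<comment> \<open>The last \<open>A\<close> of the block. Its distance \<open>a\<close> to the
    next separator fixes the window length \<open>a + 1\<close>: at \<open>n1\<close> such a window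
    has an \<open>A\<close> at both ends.\<close>
  define y where "y = Max {y. y < q - 1 \<and> f y = A}"
  have "x0 \<in> {y. y < q - 1 \<and> f y = A}"
    using x0 \<open>q > Suc x0\<close> by simp
  then have "y \<in> {y. y < q - 1 \<and> f y = A}"
    unfolding y_def by (intro Max_in) auto
  then have y: "y < q - 1" "f y = A"
    by auto
  have y_max: "f z \<noteq> A" if "y < z" "z < q - 1" for z
  proof
    assume "f z = A"
    then have "z \<le> y"
      unfolding y_def using that by (intro Max_ge) auto
    then show False
      using that by simp
  qed
  define a where "a = q - 1 - y"
  have a: "0 < a" "a < q" "q - 1 - a = y"
    using y \<open>q > Suc x0\<close> by (auto simp: a_def)
  have "f (n1 - a) = A"
    using before(1)[OF n1(1) a(1,2)] y a by simp
  have le: "a \<le> n1" "a \<le> n2"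
    using before(2)[OF n1(1) a(1,2)] before(2)[OF n2(1) a(1,2)] a by auto
  have "2 \<le> cnt (\<lambda>x. f x = A) (n1 - a) (Suc a)"
  proof -
    have "card {n1 - a, n1} \<le> cnt (\<lambda>x. f x = A) (n1 - a) (Suc a)"
      unfolding cnt_def using \<open>f (n1 - a) = A\<close> n1 le by (intro card_mono) auto
    then show ?thesis
      using a le by simp
  qed
  \<comment> \<open>The window runs from just after the last \<open>A\<close> of the block, across
    the separator \<open>n2\<close>, to the first letter of the next block. That letter also follows
    the \<open>A\<close> at \<open>n1\<close>, so it is not \<open>A\<close>.\<close>
  moreover have "cnt (\<lambda>x. f x = A) (Suc (n2 - a)) (Suc a) = 0"
  proof -
    have "f x \<noteq> A" if x: "Suc (n2 - a) \<le> x" "x < Suc (n2 - a) + Suc a" for x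
    proof -
      consider "x = Suc n2" | "x = n2" | "x < n2"
        using x le by linarith
      then show ?thesis
      proof cases
        case 1
        then show ?thesis
          using after[OF n1(1)] after[OF n2(1)] A[of n1] n1(2) by metis
      next
        case 2
        then show ?thesis
          using n2 by simp
      next
        case 3
        define d where "d = n2 - x"
        have d: "0 < d" "d < a" "x = n2 - d"
          using 3 x le by (auto simp: d_def)
        then have "f x = f (q - 1 - d)"
          using before(1)[OF n2(1), of d] a by simp
        then show ?thesis
          using y_max[of "q - 1 - d"] d a by auto
      qed
    qed
    then show ?thesis
      by (auto simp: cnt_def)
  qed
  moreover have "cnt (\<lambda>x. f x = A) (n1 - a) (Suc a) \<le> cnt (\<lambda>x. f x = A) (Suc (n2 - a)) (Suc a) + 1"
    using bal_letter[OF assms(1)] unfolding bal_def by blast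
  ultimately show False
    by simp
qed

section \<open>Rank-one words described by their runs of 1s\<close>

lemma built_from_singleton:
  assumes "built_from w {u}"
  obtains as where "as \<noteq> []" "w = concat (map (\<lambda>a. u @ replicate a 1) as) @ u"
proof -
  obtain vs as where b: "length as \<ge> 1" "length vs = length as + 1" "set vs \<subseteq> {u}"
    "w = concat (map (\<lambda>(v, a). v @ replicate a 1) (zip (butlast vs) as)) @ last vs"
    using assms unfolding built_from_def is_building_def by blast
  have vs: "vs = replicate (length as) u @ [u]"
    using replicate_eqI[of vs "Suc (length as)" u] b(2,3) replicate_append_same[of "length as" u] by auto
  have "map (\<lambda>(v, a). v @ replicate a 1) (zip (replicate (length as) u) as)
      = map (\<lambda>a. u @ replicate a 1) as"
    by (induction as) auto
  then have "w = concat (map (\<lambda>a. u @ replicate a 1) as) @ u"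
    using b(4) unfolding vs by simp
  moreover have "as \<noteq> []"
    using b(1) by auto
  ultimately show ?thesis
    using that by blast
qed

text \<open>If \<open>w\<close> lists the lengths of the runs of 1s between consecutive zeros of a
  word, this is the corresponding list after building from that word with spacers
  \<open>bs\<close>.\<close>

definition interleave :: "'a list \<Rightarrow> 'a list \<Rightarrow> 'a list" where
  "interleave w bs = concat (map (\<lambda>b. w @ [b]) bs) @ w"

text \<open>Through this identity every later stage is an interleaving of any fixed earlier
  stage.\<close>

lemma interleave_interleave:
  "interleave (interleave w bs) cs = interleave w (interleave bs cs)"
  by (induction cs) (simp_all add: interleave_def)

lemma nth_interleave:
  assumes "x < length (interleave w bs)" and "\<not> Suc (length w) dvd Suc x"
  shows "interleave w bs ! x = w ! (x mod Suc (length w))"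
  using assms
proof (induction bs arbitrary: x)
  case (Cons b bs)
  have eq: "interleave w (b # bs) = (w @ [b]) @ interleave w bs"
    by (simp add: interleave_def)
  consider "x < length w" | "x = length w" | z where "x = z + Suc (length w)"
    by (metis add.commute less_linear Suc_leI le_Suc_ex)
  then show ?case
  proof cases
    case 3
    then have "\<not> Suc (length w) dvd Suc z"
      using Cons.prems(2) by (metis add_Suc dvd_add_triv_right_iff)
    moreover have "interleave w (b # bs) ! x = interleave w bs ! z"
      unfolding eq 3 nth_append by simp
    moreover have "x mod Suc (length w) = z mod Suc (length w)"
      unfolding 3 by (rule mod_add_self2)
    ultimately show ?thesis
      using Cons.IH[of z] Cons.prems(1) 3 by (simp add: eq)
  qed (use Cons.prems in \<open>auto simp: eq nth_append\<close>)
qed (simp add: interleave_def)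

lemma prefix_run:
  assumes "Sublist.prefix (replicate x 1 @ 0 # xs) (replicate y 1 @ ys)"
    and "ys = [] \<or> hd ys = (0 :: bit)"
  shows "x = y \<and> Sublist.prefix (0 # xs) ys"
  using assms(1)
proof (induction x arbitrary: y)
  case 0
  then show ?case
    by (cases y) auto
next
  case (Suc x)
  then show ?case
    using assms(2) by (cases y; cases ys) auto
qed

text \<open>Each block starts with 0, so run lengths can be read off uniquely; the final 0 on the
  left ensures that the last run of \<open>ws\<close> is not cut short.\<close>

lemma prefix_of_prefix_runs:
  assumes "Sublist.prefix (concat (map (\<lambda>a. 0 # replicate a 1) ws) @ [0 :: bit])
    (concat (map (\<lambda>a. 0 # replicate a 1) us))"
  shows "Sublist.prefix ws us"
  using assms
proof (induction ws arbitrary: us)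
  case (Cons x xs)
  then obtain y ys where us: "us = y # ys"
    by (cases us) auto
  let ?C = "\<lambda>ws. concat (map (\<lambda>a. 0 # replicate a (1 :: bit)) ws)"
  obtain zs where zs: "?C xs @ [0] = 0 # zs"
    by (cases xs) auto
  have "?C ys = [] \<or> hd (?C ys) = 0"
    by (cases ys) auto
  moreover have "Sublist.prefix (replicate x 1 @ 0 # zs) (replicate y 1 @ ?C ys)"
    using Cons.prems unfolding us zs[symmetric] by simp
  ultimately have "x = y \<and> Sublist.prefix (0 # zs) (?C ys)"
    by (intro prefix_run)
  then show ?case
    using Cons.IH[of ys] unfolding us zs[symmetric] by simp
qed simp

lemma length_concat_ge:
  assumes "\<And>x. W x \<noteq> []"
  shows "length xs \<le> length (concat (map W xs))"
proof (induction xs)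
  case (Cons x xs)
  have "1 \<le> length (W x)"
    using assms[of x] by (simp add: Suc_le_eq)
  then show ?case
    using Cons by simp
qed simp

text \<open>The lists \<open>w i\<close> of run lengths are prefixes of the sequence
  \<open>R + of_bool (f n)\<close>. Since each later list interleaves \<open>w M\<close> with single
  entries, \<open>f\<close> repeats a block of length \<open>length (w M)\<close>, which can be made
  arbitrarily long.\<close>

lemma no_rank_one_construction:
  assumes f: "bal f" "\<not> ev_per f"
    and coded: "coded (\<lambda>b. 0 # replicate (R + of_bool b) 1) f V"
  shows "\<not> rank_one_construction V"
proof
  let ?U = "\<lambda>a. 0 # replicate a (1 :: bit)"
  let ?C = "\<lambda>ws. concat (map ?U ws) @ [0]"
  assume "rank_one_construction V"
  then obtain v where v: "v 0 = [0]" "\<And>i. built_from (v (Suc i)) {v i}"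
    "\<And>i. initial_segment (v i) V"
    unfolding rank_one_construction_def by blast
  have "\<exists>w. \<forall>i. v i = ?C (w i) \<and> (\<exists>bs. bs \<noteq> [] \<and> w (Suc i) = interleave (w i) bs)"
  proof (rule dependent_nat_choice)
    show "\<exists>w. v 0 = ?C w"
      using v(1) by (intro exI[of _ "[]"]) simp
  next
    fix w i assume w: "v i = ?C w"
    obtain bs where bs: "bs \<noteq> []" "v (Suc i) = concat (map (\<lambda>a. v i @ replicate a 1) bs) @ v i"
      using built_from_singleton[OF v(2)] by metis
    have "concat (map (\<lambda>a. ?C w @ replicate a 1) bs) @ ?C w = ?C (interleave w bs)"
      by (induction bs) (auto simp: interleave_def)
    then show "\<exists>w'. v (Suc i) = ?C w' \<and> (\<exists>bs. bs \<noteq> [] \<and> w' = interleave w bs)"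
      using bs w by metis
  qed
  then obtain w where w: "\<And>i. v i = ?C (w i)"
    and step: "\<And>i. \<exists>bs. bs \<noteq> [] \<and> w (Suc i) = interleave (w i) bs"
    by metis
  have steps: "\<exists>bs. w (i + k) = interleave (w i) bs" for i k
  proof (induction k)
    case 0
    then show ?case
      by (intro exI[of _ "[]"]) (simp add: interleave_def)
  next
    case (Suc k)
    then show ?case
      using step[of "i + k"] interleave_interleave by (metis add_Suc_right)
  qed
  have length_w: "i \<le> length (w i)" for i
  proof (induction i)
    case (Suc i)
    obtain b bs where "w (Suc i) = interleave (w i) (b # bs)"
      using step[of i] by (metis neq_Nil_conv)
    then show ?case
      using Suc by (simp add: interleave_def)
  qed simp
  define a where "a i = R + of_bool (f i)" for i
  have w_eq: "w j ! x = a x" if "x < length (w j)" for j x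
  proof -
    \<comment> \<open>The blocks are nonempty, so \<open>n\<close> of them cover the prefix
      \<open>v j\<close> of \<open>V\<close>.\<close>
    define n where "n = length (v j)"
    obtain m where m: "concat (map ?U (map a [0..<n])) = map V [0..<m]"
      using coded unfolding coded_def by (auto simp: a_def comp_def)
    have "n \<le> length (concat (map ?U (map a [0..<n])))"
      using length_concat_ge[of ?U "map a [0..<n]"] by simp
    then have "n \<le> m"
      unfolding m by simp
    moreover have "v j = map V [0..<n]"
      using v(3)[of j] by (simp add: initial_segment_def occurs_at_def subsequence_def n_def)
    ultimately have "Sublist.prefix (v j) (map V [0..<m])"
      by (metis Sublist.prefix_def le0 map_append upt_append)
    then have "Sublist.prefix (w j) (map a [0..<n])"
      unfolding m[symmetric] w by (rule prefix_of_prefix_runs)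
    then show ?thesis
      using that by (metis (no_types, lifting) Sublist.prefix_def add.left_neutral diff_zero
          length_map length_upt nth_append nth_map_upt prefix_length_le order.strict_trans2)
  qed
  show False
  proof (rule bal_no_fixed_return[OF f])
    fix M
    define q where "q = Suc (length (w M))"
    have "f x = f (x mod q)" if x: "\<not> q dvd Suc x" for x
    proof -
      \<comment> \<open>Stage \<open>M + Suc x\<close> is late enough for its list to reach position
        \<open>x\<close>.\<close>
      obtain bs where bs: "w (M + Suc x) = interleave (w M) bs"
        using steps by blast
      have less: "x < length (w (M + Suc x))"
        using length_w[of "M + Suc x"] by simp
      have "x mod q < length (w M)"
      proof -
        have "Suc (x mod q) \<noteq> q"
          using x by (auto simp: dvd_eq_mod_eq_0 mod_Suc)
        moreover have "x mod q < q"
          by (simp add: q_def)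
        ultimately show ?thesis
          by (metis less_SucE q_def)
      qed
      then have "a x = a (x mod q)"
        using nth_interleave[of x "w M" bs] less x w_eq bs by (metis q_def)
      then show ?thesis
        by (simp add: a_def of_bool_eq_iff)
    qed
    moreover have "M < q"
      using length_w[of M] by (simp add: q_def)
    ultimately show "\<exists>q>M. \<forall>x. \<not> q dvd Suc x \<longrightarrow> f x = f (x mod q)"
      by blast
  qed
qed

section \<open>The rank-two construction\<close>

text \<open>
  \<open>v\<close> gives the two words of the stage, \<open>t\<close> the spacers that always follow them, and \<open>f\<close> the order in
  which they are concatenated. The initial stage has \<open>v True = v False = [0]\<close> with different spacers.
\<close>

definition level :: "bit word \<Rightarrow> (bool \<Rightarrow> bit list) \<Rightarrow> (bool \<Rightarrow> nat) \<Rightarrow> (nat \<Rightarrow> bool) \<Rightarrow> bool" where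
  "level V v t f \<longleftrightarrow> range v \<subseteq> \<F> \<and> bal f \<and> \<not> ev_per f \<and>
     coded (\<lambda>c. v c @ replicate (t c) 1) f V"

text \<open>The first letter of the directing sequence selects the word with which \<open>V\<close>
  begins, so the condition on the first word of a building concerns \<open>f' 0\<close> and
  \<open>f 0\<close>.\<close>

definition refines :: "(bool \<Rightarrow> bit list) \<Rightarrow> (nat \<Rightarrow> bool) \<Rightarrow>
    (bool \<Rightarrow> bit list) \<Rightarrow> (nat \<Rightarrow> bool) \<Rightarrow> bool" where
  "refines v f v' f' \<longleftrightarrow> v' True \<noteq> v' False \<and>
     (\<exists>vs as. is_building (range v) (v' (f' 0)) vs as \<and> hd vs = v (f 0) \<and> set vs = range v) \<and>
     (\<forall>b. \<exists>vs as. is_building (range v) (v' b) vs as \<and> set vs = range v)"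

lemma is_building_code:
  assumes "length xs \<ge> 2"
  shows "is_building (range v)
    (concat (map (\<lambda>c. v c @ replicate (t c) 1) (butlast xs)) @ v (last xs))
    (map v xs) (map t (butlast xs))"
proof -
  have "map (\<lambda>(u, a). u @ replicate a 1) (zip (map v ys) (map t ys))
      = map (\<lambda>c. v c @ replicate (t c) 1) ys" for ys
    by (induction ys) auto
  moreover have "xs \<noteq> []"
    using assms by auto
  ultimately show ?thesis
    using assms unfolding is_building_def by (auto simp: map_butlast[symmetric] last_map)
qed

text \<open>Each new word is the product prescribed by \<open>code\<close> without the spacer after
  its last factor; that spacer is kept in \<open>t'\<close>, so the infinite product is
  unchanged.\<close>

lemma level_refine:
  assumes "level V v t f"
  obtains v' t' f' where "level V v' t' f'" "refines v f v' f'"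
proof -
  have v: "v c \<noteq> []" "hd (v c) = 0" "last (v c) = 0" for c
    using assms by (auto simp: level_def zero_bounded_words_def)
  have f: "bal f" "\<not> ev_per f" and coded: "coded (\<lambda>c. v c @ replicate (t c) 1) f V"
    using assms by (auto simp: level_def)
  obtain code f' where f': "bal f'" "\<not> ev_per f'" and code: "coded code f' f"
    and code_UNIV: "\<And>b. set (code b) = UNIV"
    and code_neq: "\<And>h :: bool \<Rightarrow> nat. (\<And>c. h c > 0) \<Longrightarrow>
       sum_list (map h (code True)) \<noteq> sum_list (map h (code False))"
    using derived_sequence[OF f] by metis
  let ?W = "\<lambda>c. v c @ replicate (t c) 1"
  have length_code: "2 \<le> length (code b)" for b
    using card_length[of "code b"] by (simp add: code_UNIV)
  have code_split: "\<exists>c ys. code b = c # ys @ [last (code b)]" for b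
  proof -
    have "butlast (code b) \<noteq> []" "code b \<noteq> []"
      using length_code[of b] by (auto simp flip: length_0_conv)
    then show ?thesis
      by (metis append_butlast_last_id append_Cons neq_Nil_conv)
  qed
  define v' where "v' b = concat (map ?W (butlast (code b))) @ v (last (code b))" for b
  define t' where "t' b = t (last (code b))" for b
  have W': "v' b @ replicate (t' b) 1 = concat (map ?W (code b))" for b
  proof -
    obtain c ys where "code b = c # ys @ [last (code b)]"
      using code_split by blast
    then show ?thesis
      unfolding v'_def t'_def
      by (metis (no_types, lifting) append.assoc append_Cons butlast_snoc concat.simps concat_append
          append_Nil2 list.map map_append)
  qed
  have "v' b \<in> \<F>" for b
  proof -
    obtain c ys where "code b = c # ys @ [last (code b)]"
      using code_split by blast
    then have "butlast (code b) = c # ys"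
      by (metis append_Cons butlast_snoc)
    then show ?thesis
      using v by (simp add: v'_def zero_bounded_words_def)
  qed
  moreover have "coded (\<lambda>c. v' c @ replicate (t' c) 1) f' V"
    unfolding W' by (rule coded_compose[OF coded code])
  ultimately have "level V v' t' f'"
    using f' by (auto simp: level_def)
  moreover have "refines v f v' f'"
    unfolding refines_def
  proof (intro conjI)
    \<comment> \<open>Spacers contain no zeros, so the number of zeros is a positive weight summed
      over \<open>code b\<close>, and \<open>code_neq\<close> separates the two words.\<close>
    have "count_list (v' b) 0 = sum_list (map (\<lambda>c. count_list (v c) 0) (code b))" for b
    proof -
      have count: "count_list (concat (map ?W ys)) 0 = sum_list (map (\<lambda>c. count_list (v c) 0) ys)" for ys
        by (induction ys) (auto simp: count_list_0_iff)
      have "count_list (v' b) 0 = count_list (v' b @ replicate (t' b) 1) 0"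
        by (simp add: count_list_0_iff)
      then show ?thesis
        unfolding W' count .
    qed
    moreover have "count_list (v c) 0 > 0" for c
      using v[of c] by (metis count_list_0_iff gr0I last_in_set)
    ultimately show "v' True \<noteq> v' False"
      using code_neq[of "\<lambda>c. count_list (v c) 0"] by metis
    have building: "is_building (range v) (v' b) (map v (code b)) (map t (butlast (code b)))"
      "set (map v (code b)) = range v" for b
      using is_building_code[OF length_code] by (simp_all add: v'_def code_UNIV)
    then show "\<forall>b. \<exists>vs as. is_building (range v) (v' b) vs as \<and> set vs = range v"
      by blast
    \<comment> \<open>The product of the code words begins with \<open>code (f' 0)\<close> and is a
      prefix of \<open>f\<close>.\<close>
    have "hd (code (f' 0)) = f 0"
    proof -
      obtain m where m: "concat (map code (map f' [0..<1])) = map f [0..<m]"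
        using code unfolding coded_def by blast
      then have "m > 0"
        using length_code[of "f' 0"] by (cases m) auto
      then show ?thesis
        using m by (simp add: upt_rec hd_map)
    qed
    moreover have "code b \<noteq> []" for b
      using length_code[of b] by auto
    ultimately have "hd (map v (code (f' 0))) = v (f 0)"
      by (simp add: hd_map)
    then show "\<exists>vs as. is_building (range v) (v' (f' 0)) vs as \<and> hd vs = v (f 0) \<and> set vs = range v"
      using building by blast
  qed
  ultimately show ?thesis
    using that by blast
qed

lemma level_initial_segment:
  assumes "level V v t f"
  shows "initial_segment (v (f 0)) V"
proof -
  obtain m where "concat (map (\<lambda>c. v c @ replicate (t c) 1) (map f [0..<1])) = map V [0..<m]"
    using assms unfolding level_def coded_def by blast
  then have "v (f 0) @ replicate (t (f 0)) 1 = map V [0..<m]"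
    by simp
  from prefix_of_map_upt[OF this] obtain l where l: "v (f 0) = map V [0..<l]" ..
  then show ?thesis
    by (simp add: initial_segment_def occurs_at_def subsequence_def)
qed

theorem theorem5p4:
  fixes V :: "bit word"
  assumes "recurrent V"
    and "balanced V"
    and "\<not> eventually_periodic V"
    and "V 0 = 0"
  shows "proper_rank_two_construction V"
proof -
  obtain R f where f: "bal f" "\<not> ev_per f"
    and coded: "coded (\<lambda>b. 0 # replicate (R + of_bool b) 1) f V"
    using initial_coding[OF assms(2-4)] by metis
  \<comment> \<open>A state is a triple of words, trailing spacers and directing sequence. The
    clause for \<open>i = 0\<close> fixes the initial words, which the refinement relation leaves
    open.\<close>
  let ?P = "\<lambda>i s. level V (fst s) (fst (snd s)) (snd (snd s)) \<and> (i = 0 \<longrightarrow> fst s = (\<lambda>_. [0]))"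
  let ?Q = "\<lambda>s s'. refines (fst s) (snd (snd s)) (fst s') (snd (snd s'))"
  have "\<exists>s. \<forall>i :: nat. ?P i (s i) \<and> ?Q (s i) (s (Suc i))"
  proof (rule dependent_nat_choice)
    have "level V (\<lambda>_. [0]) (\<lambda>b. R + of_bool b) f"
      using f coded by (auto simp: level_def zero_bounded_words_def)
    then have "?P 0 (\<lambda>_. [0], \<lambda>b. R + of_bool b, f)"
      by simp
    then show "\<exists>s. ?P 0 s"
      by (rule exI)
  next
    fix s and i :: nat
    assume "?P i s"
    then obtain v' t' f' where "level V v' t' f'" "refines (fst s) (snd (snd s)) v' f'"
      using level_refine by blast
    then have "?P (Suc i) (v', t', f') \<and> ?Q s (v', t', f')"
      by simp
    then show "\<exists>s'. ?P (Suc i) s' \<and> ?Q s s'"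
      by (rule exI[where x = "(v', t', f')"])
  qed
  then obtain s where s: "\<And>i. ?P i (s i)" "\<And>i. ?Q (s i) (s (Suc i))"
    by blast
  define v where "v i = fst (s i)" for i
  define g where "g i = snd (snd (s i))" for i
  have level: "level V (v i) (fst (snd (s i))) (g i)" for i
    using s(1)[of i] unfolding v_def g_def by blast
  have v0: "v 0 = (\<lambda>_. [0])"
    using s(1)[of 0] unfolding v_def by blast
  have refines: "refines (v i) (g i) (v (Suc i)) (g (Suc i))" for i
    using s(2)[of i] unfolding v_def g_def .
  define S where "S i = range (v i)" for i
  \<comment> \<open>The index \<open>g i 0\<close> belongs to the first factor of \<open>V\<close>,
    so this word is an initial segment; \<open>v2\<close> takes the other index.\<close>
  define v1 where "v1 i = v i (g i 0)" for i
  define v2 where "v2 i = v i (\<not> g i 0)" for i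
  have "S 0 = {[0]} \<and> v1 0 = [0] \<and> v2 0 = [0]"
    by (simp add: S_def v1_def v2_def v0)
  moreover have "S i = {v1 i, v2 i} \<and> v1 i \<noteq> v2 i \<and> S i \<subseteq> \<F>" if "i \<ge> 1" for i
  proof -
    obtain j where "i = Suc j"
      using \<open>i \<ge> 1\<close> by (cases i) auto
    then have "v i True \<noteq> v i False"
      using refines[of j] by (simp add: refines_def)
    moreover have "range (v i) = {v i True, v i False}"
      by (auto simp: UNIV_bool)
    moreover have "S i \<subseteq> \<F>"
      using level[of i] by (auto simp: S_def level_def)
    ultimately show ?thesis
      by (cases "g i 0") (auto simp: S_def v1_def v2_def)
  qed
  moreover have "(\<exists>vs as. is_building (S i) (v1 (Suc i)) vs as \<and> hd vs = v1 i \<and> set vs = S i) \<and>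
      (\<exists>vs as. is_building (S i) (v2 (Suc i)) vs as \<and> set vs = S i)" for i
    using refines[of i] unfolding refines_def S_def v1_def v2_def by blast
  moreover have "initial_segment (v1 i) V" for i
    using level[of i] level_initial_segment unfolding v1_def by blast
  ultimately show ?thesis
    using no_rank_one_construction[OF f coded] unfolding proper_rank_two_construction_def by blast
qed

end
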